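(* For $n\ge1$ let $S_n(132)$ be the set of $132$-avoiding permutations of $\{1,\dots,n\}$, and for $\sigma=\sigma_1\cdots\sigma_n$ let $\mathrm{box}(\sigma)$ be the number of indices $i$ such that $|\sigma_i-\sigma_{i+1}|=1$ or $|\sigma_{i-1}-\sigma_i|=1$ (ignoring nonexistent entries). Let $A_n(x)=\sum_{\sigma\in S_n(132)}x^{\mathrm{box}(\sigma)}$, $B_n(x)=\sum_{\sigma\in S_n(132),\sigma_1=n}x^{\mathrm{box}(\sigma)}$, $E_n(x)=\sum_{\sigma\in S_n(132),\sigma_n=n}x^{\mathrm{box}(\sigma)}$. Then for $n\ge3$, $A_n(x)|_{x^3}=F_{n-1}$ and $B_n(x)|_{x^3}=E_n(x)|_{x^3}=F_{n-3}$.
   Context: A permutation $\sigma\in S_n$ avoids $132$ if there are no indices $i<j<k$ with $\sigma_i<\sigma_k<\sigma_j$. $P(x)|_{x^m}$ denotes the coefficient of $x^m$ in the polynomial $P(x)$. The Fibonacci numbers are defined by $F_0=F_1=1$ and $F_n=F_{n-1}+F_{n-2}$ for $n\ge2$. *)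

theory Defs
  imports
    "HOL-Combinatorics.Permutations"
    "HOL-Computational_Algebra.Polynomial"
    "HOL-Number_Theory.Fib"
begin

definition avoids_132 :: "nat \<Rightarrow> (nat \<Rightarrow> nat) \<Rightarrow> bool" where
  "avoids_132 n \<sigma> \<longleftrightarrow>
     \<not> (\<exists>i\<in>{1..n}. \<exists>j\<in>{1..n}. \<exists>k\<in>{1..n}. i < j \<and> j < k \<and> \<sigma> i < \<sigma> k \<and> \<sigma> k < \<sigma> j)"

definition S132 :: "nat \<Rightarrow> (nat \<Rightarrow> nat) set" where
  "S132 n = {\<sigma>. \<sigma> permutes {1..n} \<and> avoids_132 n \<sigma>}"

(* The integer coercions avoid truncated subtraction; the guards i < n and 1 < i discard
   the nonexistent entries with index n + 1 and 0. *)
definition box :: "nat \<Rightarrow> (nat \<Rightarrow> nat) \<Rightarrow> nat" where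
  "box n \<sigma> = card {i\<in>{1..n}.
     (i < n \<and> \<bar>int (\<sigma> i) - int (\<sigma> (i + 1))\<bar> = 1) \<or>
     (1 < i \<and> \<bar>int (\<sigma> (i - 1)) - int (\<sigma> i)\<bar> = 1)}"

definition A :: "nat \<Rightarrow> int poly" where
  "A n = (\<Sum>\<sigma>\<in>S132 n. monom 1 (box n \<sigma>))"

definition B :: "nat \<Rightarrow> int poly" where
  "B n = (\<Sum>\<sigma>\<in>{\<sigma>\<in>S132 n. \<sigma> 1 = n}. monom 1 (box n \<sigma>))"

definition E :: "nat \<Rightarrow> int poly" where
  "E n = (\<Sum>\<sigma>\<in>{\<sigma>\<in>S132 n. \<sigma> n = n}. monom 1 (box n \<sigma>))"

(* Fibonacci numbers normalised by F 0 = F 1 = 1, whereas the library has fib 0 = 0. *)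
fun F :: "nat \<Rightarrow> nat" where
  "F 0 = 1"
| "F (Suc 0) = 1"
| "F (Suc (Suc n)) = F (Suc n) + F n"

lemma F_eq_fib: "F n = fib (Suc n)"
  by (induction n rule: F.induct) simp_all

lemma finite_S132: "finite (S132 n)"
  unfolding S132_def by (rule finite_subset[OF _ finite_permutations[of "{1..n}"]]) auto

end

theory Submission imports Defs begin

text \<open>Every 132-avoiding arrangement of at least two consecutive values has two neighbouring entries
  differing by 1, so two disjoint blocks of this kind already force \<^term>\<open>box n \<sigma> \<ge> 4\<close>. The entries
  before the maximum, and those after it, each take consecutive values; hence for
  \<^term>\<open>n \<ge> 4\<close> and \<^term>\<open>box n \<sigma> = 3\<close> the maximum is at position \<^term>\<open>1\<close>, \<^term>\<open>n - 1\<close> or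
  \<^term>\<open>n\<close>. Writing $a_n, b_n, e_n$ for the three coefficients and removing the maximum, or in the
  middle case the trailing minimum, gives $b_n = a_{n-1} - b_{n-1}$, $e_n = a_{n-1} - e_{n-1}$ and
  $a_n = b_n + e_n + e_{n-1}$.\<close>

section \<open>Bonds and the box statistic\<close>

text \<open>A bond is indexed by its left position. Successor equations replace the integer absolute
  difference, so later arguments stay within \<open>nat\<close>.\<close>

definition bond :: "(nat \<Rightarrow> nat) \<Rightarrow> nat \<Rightarrow> bool" where
  "bond \<sigma> i \<longleftrightarrow> \<sigma> (Suc i) = Suc (\<sigma> i) \<or> \<sigma> i = Suc (\<sigma> (Suc i))"

definition box_set :: "nat \<Rightarrow> (nat \<Rightarrow> nat) \<Rightarrow> nat set" where
  "box_set n \<sigma> = {i \<in> {1..n}. (i < n \<and> bond \<sigma> i) \<or> (1 < i \<and> bond \<sigma> (i - 1))}"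

lemma box_eq_card: "box n \<sigma> = card (box_set n \<sigma>)"
  unfolding box_def box_set_def
  by (rule arg_cong[where f = card], rule Collect_cong) (auto simp: bond_def)

lemma finite_box_set: "finite (box_set n \<sigma>)"
  by (simp add: box_set_def)

text \<open>The gap \<open>Suc i < j\<close> makes the four positions covered by the two bonds
  distinct.\<close>

lemma box_ge_4:
  assumes "bond \<sigma> i" "bond \<sigma> j" "1 \<le> i" "Suc i < j" "j < n"
  shows "box n \<sigma> \<ge> 4"
proof -
  have "{i, Suc i, j, Suc j} \<subseteq> box_set n \<sigma>"
    using assms by (auto simp: box_set_def)
  then have "card {i, Suc i, j, Suc j} \<le> box n \<sigma>"
    unfolding box_eq_card by (rule card_mono[OF finite_box_set])
  with assms show ?thesis by simp
qed

text \<open>At the leftmost ascent, avoidance of 132 and the descents before it leave no room for a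
  value between \<^term>\<open>\<sigma> i\<close> and the smaller of its two neighbours.\<close>
lemma bond_exists:
  fixes \<sigma> :: "nat \<Rightarrow> nat"
  assumes lr: "l < r" and inj: "inj_on \<sigma> {l..r}"
    and conv: "\<And>i j x. i \<in> {l..r} \<Longrightarrow> j \<in> {l..r} \<Longrightarrow> \<sigma> i < x \<Longrightarrow> x < \<sigma> j \<Longrightarrow> x \<in> \<sigma> ` {l..r}"
    and av: "\<And>i j k. l \<le> i \<Longrightarrow> i < j \<Longrightarrow> j < k \<Longrightarrow> k \<le> r \<Longrightarrow> \<sigma> i < \<sigma> k \<Longrightarrow> \<sigma> k < \<sigma> j \<Longrightarrow> False"
  obtains i where "l \<le> i" "i < r" "bond \<sigma> i"
proof -
  have desc: "\<sigma> b < \<sigma> a"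
    if "\<And>i. l \<le> i \<Longrightarrow> i < m \<Longrightarrow> \<sigma> (Suc i) < \<sigma> i" "l \<le> a" "a < b" "b \<le> m" for a b m
    using that(3,4)
  proof (induction b)
    case (Suc b)
    have "\<sigma> (Suc b) < \<sigma> b" using that(1)[of b] Suc.prems that(2) by simp
    with Suc show ?case by (cases "a = b") auto
  qed simp
  show thesis
  proof (cases "\<exists>i. l \<le> i \<and> i < r \<and> \<sigma> i < \<sigma> (Suc i)")
    case False
    have neq: "\<sigma> (Suc i) \<noteq> \<sigma> i" if "l \<le> i" "i < r" for i
      using inj_onD[OF inj, of "Suc i" i] that by auto
    have d: "\<sigma> (Suc i) < \<sigma> i" if "l \<le> i" "i < r" for i
      using False neq[OF that] that by (meson linorder_neqE_nat)
    \<comment> \<open>Without an ascent the whole block decreases, so a value strictly between its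
      first two entries would have no position.\<close>
    have "\<sigma> l = Suc (\<sigma> (Suc l))"
    proof (rule ccontr)
      assume "\<sigma> l \<noteq> Suc (\<sigma> (Suc l))"
      then have "Suc (\<sigma> (Suc l)) \<in> \<sigma> ` {l..r}"
        using conv[of "Suc l" l "Suc (\<sigma> (Suc l))"] lr d[of l] by auto
      then obtain k where k: "l \<le> k" "k \<le> r" "\<sigma> k = Suc (\<sigma> (Suc l))" by auto
      have "k \<noteq> l" "k \<noteq> Suc l" using k \<open>\<sigma> l \<noteq> _\<close> by auto
      with k desc[of r "Suc l" k] d show False by auto
    qed
    then show thesis using that[of l] lr by (auto simp: bond_def)
  next
    case True
    define i where "i = (LEAST i. l \<le> i \<and> i < r \<and> \<sigma> i < \<sigma> (Suc i))"
    have i: "l \<le> i" "i < r" "\<sigma> i < \<sigma> (Suc i)"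
      using LeastI_ex[OF True] by (auto simp: i_def)
    have d: "\<sigma> (Suc k) < \<sigma> k" if "l \<le> k" "k < i" for k
    proof -
      have "\<not> \<sigma> k < \<sigma> (Suc k)"
        using not_less_Least[of k "\<lambda>i. l \<le> i \<and> i < r \<and> \<sigma> i < \<sigma> (Suc i)"] that i
        by (auto simp: i_def)
      moreover have "\<sigma> k \<noteq> \<sigma> (Suc k)" using inj_onD[OF inj, of k "Suc k"] that i by auto
      ultimately show ?thesis by simp
    qed
    show thesis
    proof (cases "bond \<sigma> i")
      case True
      then show thesis using that i by blast
    next
      case False
      then have "Suc (\<sigma> i) < \<sigma> (Suc i)" using i by (auto simp: bond_def)
      with conv[of i "Suc i"] i have "Suc (\<sigma> i) \<in> \<sigma> ` {l..r}" by auto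
      then obtain k where k: "l \<le> k" "k \<le> r" "\<sigma> k = Suc (\<sigma> i)" by auto
      \<comment> \<open>To the right of \<open>Suc i\<close>, the value
        \<open>Suc (\<sigma> i)\<close> would complete a 132 pattern.\<close>
      have "\<not> Suc i < k" using av[of i "Suc i" k] k i \<open>Suc (\<sigma> i) < _\<close> by auto
      moreover have "k \<noteq> i" "k \<noteq> Suc i" using k \<open>Suc (\<sigma> i) < _\<close> by auto
      ultimately have ki: "k < i" by simp
      \<comment> \<open>The entries descend up to \<open>i\<close>, so otherwise
        \<open>\<sigma> (i - 1)\<close> would lie strictly between \<open>\<sigma> i\<close> and its
        successor \<open>\<sigma> k\<close>.\<close>
      have "k = i - 1"
      proof (rule ccontr)
        assume "k \<noteq> i - 1"
        with ki have "\<sigma> (i - 1) < \<sigma> k" using desc[of i k "i - 1"] d k by auto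
        moreover have "\<sigma> i < \<sigma> (i - 1)" using d[of "i - 1"] ki k by auto
        ultimately show False using k by simp
      qed
      then show thesis using that[of k] k i ki by (auto simp: bond_def)
    qed
  qed
qed

section \<open>Bonds in blocks of a 132-avoiding permutation\<close>

lemma S132_D:
  assumes "\<sigma> \<in> S132 n"
  shows "\<sigma> permutes {1..n}" "inj \<sigma>"
    and "\<And>i j k. 1 \<le> i \<Longrightarrow> i < j \<Longrightarrow> j < k \<Longrightarrow> k \<le> n \<Longrightarrow> \<sigma> i < \<sigma> k \<Longrightarrow> \<sigma> k < \<sigma> j \<Longrightarrow> False"
proof -
  show p: "\<sigma> permutes {1..n}" using assms by (simp add: S132_def)
  then show "inj \<sigma>" by (rule permutes_inj)
  fix i j k assume "1 \<le> i" "i < j" "j < k" "k \<le> n" "\<sigma> i < \<sigma> k" "\<sigma> k < \<sigma> j"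
  moreover from this have "i \<in> {1..n}" "j \<in> {1..n}" "k \<in> {1..n}" by auto
  ultimately show False using assms unfolding S132_def avoids_132_def by blast
qed

lemma S132_le: "\<sigma> \<in> S132 n \<Longrightarrow> 1 \<le> i \<Longrightarrow> i \<le> n \<Longrightarrow> 1 \<le> \<sigma> i \<and> \<sigma> i \<le> n"
  using permutes_in_image[OF S132_D(1), of \<sigma> n i] by simp

lemma S132_preimage:
  assumes "\<sigma> \<in> S132 n" "1 \<le> x" "x \<le> n"
  obtains k where "1 \<le> k" "k \<le> n" "\<sigma> k = x"
proof -
  have "x \<in> \<sigma> ` {1..n}" using permutes_image[OF S132_D(1)[OF assms(1)]] assms by simp
  then show thesis using that by auto
qed

text \<open>Restates \<open>bond_exists\<close> with the convexity of the value set expressed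
  through positions: a value between two block values lies in \<open>{1..n}\<close>, so it has a
  position, which the last hypothesis puts in the block.\<close>

lemma bond_in_interval:
  assumes "\<sigma> \<in> S132 n" "1 \<le> l" "l < r" "r \<le> n"
    and "\<And>i j k. \<lbrakk>i \<in> {l..r}; j \<in> {l..r}; k \<in> {1..n}; \<sigma> i < \<sigma> k; \<sigma> k < \<sigma> j\<rbrakk> \<Longrightarrow> k \<in> {l..r}"
  obtains i where "l \<le> i" "i < r" "bond \<sigma> i"
proof (rule bond_exists[OF assms(3), of \<sigma>])
  show "inj_on \<sigma> {l..r}" using S132_D(2)[OF assms(1)] inj_on_subset by blast
next
  fix i j x assume *: "i \<in> {l..r}" "j \<in> {l..r}" "\<sigma> i < x" "x < \<sigma> j"
  have "1 \<le> j" "j \<le> n" using *(2) assms(2,4) by auto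
  from S132_le[OF assms(1) this] * have "1 \<le> x" "x \<le> n" by auto
  then obtain k where "1 \<le> k" "k \<le> n" "\<sigma> k = x" by (rule S132_preimage[OF assms(1)])
  with * assms(5)[of i j k] show "x \<in> \<sigma> ` {l..r}" by auto
next
  fix i j k assume "l \<le> i" "i < j" "j < k" "k \<le> r" "\<sigma> i < \<sigma> k" "\<sigma> k < \<sigma> j"
  then show False using S132_D(3)[OF assms(1), of i j k] assms(2,4) by simp
qed (use that in auto)

text \<open>A smaller entry before the maximum and a larger one after it would form a 132 pattern
  with the maximum. So no later value falls between two earlier ones, and the block before
  \<open>p\<close> is convex.\<close>

lemma bond_before_max:
  assumes s: "\<sigma> \<in> S132 n" and "\<sigma> p = n" "p \<le> n" "3 \<le> p"
  obtains i where "1 \<le> i" "Suc i < p" "bond \<sigma> i"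
proof (rule bond_in_interval[OF s, of 1 "p - 1"])
  fix i j k assume *: "i \<in> {1..p-1}" "j \<in> {1..p-1}" "k \<in> {1..n}" "\<sigma> i < \<sigma> k" "\<sigma> k < \<sigma> j"
  then have "1 \<le> j" "j \<le> n" using assms by auto
  with * have "\<sigma> k < n" using S132_le[OF s, of j] by auto
  moreover have "i < p" using *(1) assms(4) by auto
  ultimately have "k \<noteq> p" "\<not> p < k" using assms * S132_D(3)[OF s, of i p k] by auto
  then show "k \<in> {1..p-1}" using * by auto
qed (use assms that in auto)

text \<open>The same pattern seen from the other side: no entry before the maximum lies below one
  after it, so the block after \<open>p\<close> is convex.\<close>

lemma bond_after_max:
  assumes s: "\<sigma> \<in> S132 n" and "\<sigma> p = n" "1 \<le> p" "p + 2 \<le> n"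
  obtains i where "p < i" "i < n" "bond \<sigma> i"
proof (rule bond_in_interval[OF s, of "Suc p" n])
  fix i j k assume *: "i \<in> {Suc p..n}" "j \<in> {Suc p..n}" "k \<in> {1..n}" "\<sigma> i < \<sigma> k" "\<sigma> k < \<sigma> j"
  have "\<sigma> j \<le> n" using S132_le[OF s, of j] assms * by auto
  moreover have "\<sigma> j \<noteq> n" using injD[OF S132_D(2)[OF s], of j p] assms * by auto
  ultimately have "\<sigma> j < n" by simp
  then have "k \<noteq> p" "\<not> k < p" using assms * S132_D(3)[OF s, of k p j] by auto
  then show "k \<in> {Suc p..n}" using * by auto
qed (use assms that in \<open>auto simp: Suc_le_eq\<close>)

section \<open>Constraints imposed by box number 3\<close>

text \<open>At any other position \<open>p\<close> the maximum has a bond entirely to its right and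
  another within positions \<open>1\<close> to \<open>p\<close>; these are disjoint and force the
  box number up to 4.\<close>

lemma position_max_cases:
  assumes s: "\<sigma> \<in> S132 n" and "4 \<le> n" "box n \<sigma> = 3"
  shows "\<sigma> 1 = n \<or> \<sigma> (n - 1) = n \<or> \<sigma> n = n"
proof -
  obtain p where p: "1 \<le> p" "p \<le> n" "\<sigma> p = n"
    using S132_preimage[OF s, of n] assms by auto
  have False if pn: "p \<noteq> 1" "p \<noteq> n - 1" "p \<noteq> n"
  proof -
    have "p + 2 \<le> n" using pn p by auto
    then obtain j where j: "p < j" "j < n" "bond \<sigma> j"
      using bond_after_max[OF s p(3)] p by blast
    obtain i where i: "1 \<le> i" "Suc i \<le> p" "bond \<sigma> i"
    \<comment> \<open>Here a single entry precedes the maximum, so the left bond must use the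
      maximum itself: were \<open>\<sigma> 1\<close> not \<open>n - 1\<close>, the value
      \<open>n - 1\<close> further right would complete a 132 pattern.\<close>
    proof (cases "p = 2")
      case True
      have "\<sigma> 1 = n - 1"
      proof (rule ccontr)
        assume "\<sigma> 1 \<noteq> n - 1"
        moreover have "\<sigma> 1 \<noteq> n" using injD[OF S132_D(2)[OF s], of 1 p] p True by auto
        moreover have "\<sigma> 1 \<le> n" using S132_le[OF s, of 1] assms by simp
        moreover obtain k where k: "1 \<le> k" "k \<le> n" "\<sigma> k = n - 1"
          by (rule S132_preimage[OF s, of "n - 1"]) (use assms that in auto)
        moreover have "k \<noteq> 1" "k \<noteq> 2" using k \<open>\<sigma> 1 \<noteq> n - 1\<close> p True assms by auto
        ultimately have "1 < (2::nat)" "2 < k" "\<sigma> 1 < \<sigma> k" "\<sigma> k < \<sigma> 2"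
          using p True assms(2) by auto
        with S132_D(3)[OF s, of 1 2 k] k show False by simp
      qed
      then have "bond \<sigma> 1" using p True assms by (simp add: bond_def numeral_2_eq_2)
      then show thesis using that[of 1] True by simp
    next
      case False
      then have "3 \<le> p" using p pn by simp
      from bond_before_max[OF s p(3,2) this] obtain i where "1 \<le> i" "Suc i < p" "bond \<sigma> i"
        by blast
      then show thesis using that[of i] by simp
    qed
    have "4 \<le> box n \<sigma>" by (rule box_ge_4[of \<sigma> i j]) (use i j in auto)
    with assms show False by simp
  qed
  with p show ?thesis by metis
qed

text \<open>The bond places \<open>n\<close> and \<open>n - 1\<close> on the first two positions.
  The remaining block has at least two entries and contains a second, disjoint bond.\<close>

lemma box_ge_4_start:
  assumes s: "\<sigma> \<in> S132 n" and "4 \<le> n" "\<sigma> 1 = n" "bond \<sigma> 1"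
  shows "4 \<le> box n \<sigma>"
proof -
  have s2: "\<sigma> (Suc 1) = n - 1"
    using assms S132_le[OF s, of 2] by (auto simp: bond_def numeral_2_eq_2)
  obtain j where "3 \<le> j" "j < n" "bond \<sigma> j"
  proof (rule bond_in_interval[OF s, of 3 n])
    fix i j k assume *: "i \<in> {3..n}" "j \<in> {3..n}" "k \<in> {1..n}" "\<sigma> i < \<sigma> k" "\<sigma> k < \<sigma> j"
    have "\<sigma> j \<le> n" using S132_le[OF s, of j] * by auto
    moreover have "\<sigma> j \<noteq> n" using injD[OF S132_D(2)[OF s], of j 1] assms * by auto
    ultimately have "k \<noteq> 1" "k \<noteq> Suc 1" using assms * s2 by auto
    then show "k \<in> {3..n}" using * by auto
  qed (use assms that in auto)
  then show ?thesis using box_ge_4[of \<sigma> 1 j] assms by auto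
qed

text \<open>Mirror case: \<open>n - 1\<close> and \<open>n\<close> fill the last two positions, and
  the second bond lies in the block before them.\<close>

lemma box_ge_4_end:
  assumes s: "\<sigma> \<in> S132 n" and "4 \<le> n" "\<sigma> n = n" "bond \<sigma> (n - 1)"
  shows "4 \<le> box n \<sigma>"
proof -
  have s2: "\<sigma> (n - 1) = n - 1"
    using assms(2-4) S132_le[OF s, of "n - 1"] by (simp add: bond_def) linarith
  obtain j where "1 \<le> j" "j < n - 2" "bond \<sigma> j"
  proof (rule bond_in_interval[OF s, of 1 "n - 2"])
    fix i j k assume *: "i \<in> {1..n-2}" "j \<in> {1..n-2}" "k \<in> {1..n}" "\<sigma> i < \<sigma> k" "\<sigma> k < \<sigma> j"
    have "\<sigma> j \<le> n" using S132_le[OF s, of j] * by auto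
    moreover have "\<sigma> j \<noteq> n" using injD[OF S132_D(2)[OF s], of j n] assms * by auto
    ultimately have "k \<noteq> n - 1" "k \<noteq> n" using assms * s2 by auto
    then show "k \<in> {1..n-2}" using * by auto
  qed (use assms that in auto)
  then show ?thesis using box_ge_4[of \<sigma> j "n - 1"] assms by auto
qed

section \<open>Adding or removing an extreme entry\<close>

lemma avoids_132I:
  assumes "\<And>i j k. 1 \<le> i \<Longrightarrow> i < j \<Longrightarrow> j < k \<Longrightarrow> k \<le> n \<Longrightarrow> \<sigma> i < \<sigma> k \<Longrightarrow> \<sigma> k < \<sigma> j \<Longrightarrow> False"
  shows "avoids_132 n \<sigma>"
  using assms unfolding avoids_132_def by (metis atLeastAtMost_iff)

text \<open>An equality of sets, not merely a bijection: a permutation of \<open>{1..m}\<close> is a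
  function on all naturals that already fixes \<open>Suc m\<close>. A final maximum cannot take part
  in a 132 pattern.\<close>

lemma S132_fix_last: "{\<sigma> \<in> S132 (Suc m). \<sigma> (Suc m) = Suc m} = S132 m"
proof (intro set_eqI iffI)
  fix \<sigma> assume "\<sigma> \<in> {\<sigma> \<in> S132 (Suc m). \<sigma> (Suc m) = Suc m}"
  then have s: "\<sigma> \<in> S132 (Suc m)" and f: "\<sigma> (Suc m) = Suc m" by auto
  have "\<sigma> permutes {1..m}"
    by (rule permutes_superset[OF S132_D(1)[OF s]]) (use f in \<open>auto simp: atLeastAtMostSuc_conv\<close>)
  moreover have "avoids_132 m \<sigma>"
    by (rule avoids_132I) (meson S132_D(3)[OF s] le_SucI)
  ultimately show "\<sigma> \<in> S132 m" by (simp add: S132_def)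
next
  fix \<sigma> assume s: "\<sigma> \<in> S132 m"
  have f: "\<sigma> (Suc m) = Suc m" using permutes_not_in[OF S132_D(1)[OF s], of "Suc m"] by simp
  have "\<sigma> permutes {1..Suc m}" by (rule permutes_subset[OF S132_D(1)[OF s]]) auto
  moreover have "avoids_132 (Suc m) \<sigma>"
  proof (rule avoids_132I)
    fix i j k assume *: "1 \<le> i" "i < j" "j < k" "k \<le> Suc m" "\<sigma> i < \<sigma> k" "\<sigma> k < \<sigma> j"
    have "k \<noteq> Suc m" using f * S132_le[OF s, of j] by auto
    then show False using S132_D(3)[OF s, of i j k] * by simp
  qed
  ultimately show "\<sigma> \<in> {\<sigma> \<in> S132 (Suc m). \<sigma> (Suc m) = Suc m}" using f by (simp add: S132_def)
qed

text \<open>The cyclic shift of \<open>{1..n}\<close>. Composed on the right it moves positions,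
  composed on the left it moves values.\<close>

definition rot :: "nat \<Rightarrow> nat \<Rightarrow> nat" where
  "rot n i = (if i \<in> {1..<n} then Suc i else if i = n then 1 else i)"

definition rot_inv :: "nat \<Rightarrow> nat \<Rightarrow> nat" where
  "rot_inv n i = (if i = 1 then n else if i \<in> {2..n} then i - 1 else i)"

lemma rot_rot_inv: "1 \<le> n \<Longrightarrow> rot n (rot_inv n i) = i" "1 \<le> n \<Longrightarrow> rot_inv n (rot n i) = i"
  by (auto simp: rot_def rot_inv_def)

lemma rot_permutes: assumes "1 \<le> n" shows "rot n permutes {1..n}" "rot_inv n permutes {1..n}"
proof -
  show "rot n permutes {1..n}"
    by (rule bij_imp_permutes, rule bij_betw_byWitness[where f' = "rot_inv n"])
       (use assms in \<open>auto simp: rot_rot_inv, auto simp: rot_def rot_inv_def split: if_splits\<close>)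
  show "rot_inv n permutes {1..n}"
    by (rule bij_imp_permutes, rule bij_betw_byWitness[where f' = "rot n"])
       (use assms in \<open>auto simp: rot_rot_inv, auto simp: rot_def rot_inv_def split: if_splits\<close>)
qed

text \<open>Elements of \<open>S132 m\<close> fix \<open>Suc m\<close>, and shifting positions
  brings this value to the front. A leading maximum cannot start a 132 pattern, so avoidance is
  preserved both ways.\<close>

lemma S132_max_first:
  "bij_betw (\<lambda>\<sigma>. \<sigma> \<circ> rot_inv (Suc m)) (S132 m) {\<sigma> \<in> S132 (Suc m). \<sigma> 1 = Suc m}"
proof (rule bij_betw_byWitness[where f' = "\<lambda>\<sigma>. \<sigma> \<circ> rot (Suc m)"])
  show "\<forall>\<sigma>\<in>S132 m. \<sigma> \<circ> rot_inv (Suc m) \<circ> rot (Suc m) = \<sigma>"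
    "\<forall>\<sigma>\<in>{\<sigma> \<in> S132 (Suc m). \<sigma> 1 = Suc m}. \<sigma> \<circ> rot (Suc m) \<circ> rot_inv (Suc m) = \<sigma>"
    by (auto simp: fun_eq_iff rot_rot_inv)
  show "(\<lambda>\<sigma>. \<sigma> \<circ> rot_inv (Suc m)) ` S132 m \<subseteq> {\<sigma> \<in> S132 (Suc m). \<sigma> 1 = Suc m}"
  proof clarify
    fix \<sigma> assume s: "\<sigma> \<in> S132 m"
    have f: "\<sigma> (Suc m) = Suc m" using permutes_not_in[OF S132_D(1)[OF s], of "Suc m"] by simp
    have v: "(\<sigma> \<circ> rot_inv (Suc m)) 1 = Suc m"
        "2 \<le> i \<Longrightarrow> i \<le> Suc m \<Longrightarrow> (\<sigma> \<circ> rot_inv (Suc m)) i = \<sigma> (i - 1)" for i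
      using f by (auto simp: rot_inv_def)
    have "\<sigma> permutes {1..Suc m}" by (rule permutes_subset[OF S132_D(1)[OF s]]) auto
    then have "\<sigma> \<circ> rot_inv (Suc m) permutes {1..Suc m}"
      by (intro permutes_compose rot_permutes) auto
    moreover have "avoids_132 (Suc m) (\<sigma> \<circ> rot_inv (Suc m))"
    proof (rule avoids_132I)
      fix i j k assume *: "1 \<le> i" "i < j" "j < k" "k \<le> Suc m"
        "(\<sigma> \<circ> rot_inv (Suc m)) i < (\<sigma> \<circ> rot_inv (Suc m)) k"
        "(\<sigma> \<circ> rot_inv (Suc m)) k < (\<sigma> \<circ> rot_inv (Suc m)) j"
      have "i \<noteq> 1"
      proof
        assume "i = 1"
        with * have "1 \<le> k - 1" "k - 1 \<le> m" by auto
        from S132_le[OF s this] \<open>i = 1\<close> * show False using v(1) v(2)[of k] by auto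
      qed
      with * have "1 \<le> i - 1" "i - 1 < j - 1" "j - 1 < k - 1" "k - 1 \<le> m" by auto
      from S132_D(3)[OF s this] show False
        using \<open>i \<noteq> 1\<close> * v(2)[of i] v(2)[of j] v(2)[of k] by auto
    qed
    ultimately show "\<sigma> \<circ> rot_inv (Suc m) \<in> S132 (Suc m) \<and> (\<sigma> \<circ> rot_inv (Suc m)) 1 = Suc m"
      using v(1) by (simp add: S132_def)
  qed
  show "(\<lambda>\<sigma>. \<sigma> \<circ> rot (Suc m)) ` {\<sigma> \<in> S132 (Suc m). \<sigma> 1 = Suc m} \<subseteq> S132 m"
  proof clarify
    fix \<sigma> assume s: "\<sigma> \<in> S132 (Suc m)" and f: "\<sigma> 1 = Suc m"
    have v: "(\<sigma> \<circ> rot (Suc m)) (Suc m) = Suc m"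
        "1 \<le> i \<Longrightarrow> i \<le> m \<Longrightarrow> (\<sigma> \<circ> rot (Suc m)) i = \<sigma> (Suc i)" for i
      using f by (auto simp: rot_def)
    have "\<sigma> \<circ> rot (Suc m) permutes {1..Suc m}"
      by (intro permutes_compose rot_permutes S132_D(1)[OF s]) auto
    then have "\<sigma> \<circ> rot (Suc m) permutes {1..m}"
      by (rule permutes_superset) (use v in \<open>auto simp: atLeastAtMostSuc_conv\<close>)
    moreover have "avoids_132 m (\<sigma> \<circ> rot (Suc m))"
    proof (rule avoids_132I)
      fix i j k assume *: "1 \<le> i" "i < j" "j < k" "k \<le> m"
        "(\<sigma> \<circ> rot (Suc m)) i < (\<sigma> \<circ> rot (Suc m)) k"
        "(\<sigma> \<circ> rot (Suc m)) k < (\<sigma> \<circ> rot (Suc m)) j"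
      then show False using S132_D(3)[OF s, of "Suc i" "Suc j" "Suc k"] v(2)[of i] v(2)[of j] v(2)[of k]
        by auto
    qed
    ultimately show "\<sigma> \<circ> rot (Suc m) \<in> S132 m" by (simp add: S132_def)
  qed
qed

text \<open>Shifting values raises the first \<open>m\<close> entries by one and turns the fixed
  last value \<open>Suc m\<close> into \<open>1\<close>. A trailing minimum cannot end a 132
  pattern.\<close>

lemma S132_min_last:
  "bij_betw (\<lambda>\<sigma>. rot (Suc m) \<circ> \<sigma>) (S132 m) {\<sigma> \<in> S132 (Suc m). \<sigma> (Suc m) = 1}"
proof (rule bij_betw_byWitness[where f' = "\<lambda>\<sigma>. rot_inv (Suc m) \<circ> \<sigma>"])
  show "\<forall>\<sigma>\<in>S132 m. rot_inv (Suc m) \<circ> (rot (Suc m) \<circ> \<sigma>) = \<sigma>"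
    "\<forall>\<sigma>\<in>{\<sigma> \<in> S132 (Suc m). \<sigma> (Suc m) = 1}. rot (Suc m) \<circ> (rot_inv (Suc m) \<circ> \<sigma>) = \<sigma>"
    by (auto simp: fun_eq_iff rot_rot_inv)
  show "(\<lambda>\<sigma>. rot (Suc m) \<circ> \<sigma>) ` S132 m \<subseteq> {\<sigma> \<in> S132 (Suc m). \<sigma> (Suc m) = 1}"
  proof clarify
    fix \<sigma> assume s: "\<sigma> \<in> S132 m"
    have f: "\<sigma> (Suc m) = Suc m" using permutes_not_in[OF S132_D(1)[OF s], of "Suc m"] by simp
    have v: "(rot (Suc m) \<circ> \<sigma>) (Suc m) = 1"
        "1 \<le> i \<Longrightarrow> i \<le> m \<Longrightarrow> (rot (Suc m) \<circ> \<sigma>) i = Suc (\<sigma> i)" for i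
      using f S132_le[OF s, of i] by (auto simp: rot_def)
    have "\<sigma> permutes {1..Suc m}" by (rule permutes_subset[OF S132_D(1)[OF s]]) auto
    then have "rot (Suc m) \<circ> \<sigma> permutes {1..Suc m}"
      by (intro permutes_compose rot_permutes) auto
    moreover have "avoids_132 (Suc m) (rot (Suc m) \<circ> \<sigma>)"
    proof (rule avoids_132I)
      fix i j k assume *: "1 \<le> i" "i < j" "j < k" "k \<le> Suc m"
        "(rot (Suc m) \<circ> \<sigma>) i < (rot (Suc m) \<circ> \<sigma>) k"
        "(rot (Suc m) \<circ> \<sigma>) k < (rot (Suc m) \<circ> \<sigma>) j"
      have "k \<noteq> Suc m"
      proof
        assume "k = Suc m"
        then show False using * v(1) v(2)[of i] by auto
      qed
      then show False using S132_D(3)[OF s, of i j k] * v(2)[of i] v(2)[of j] v(2)[of k] by auto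
    qed
    ultimately show "rot (Suc m) \<circ> \<sigma> \<in> S132 (Suc m) \<and> (rot (Suc m) \<circ> \<sigma>) (Suc m) = 1"
      using v(1) by (simp add: S132_def)
  qed
  show "(\<lambda>\<sigma>. rot_inv (Suc m) \<circ> \<sigma>) ` {\<sigma> \<in> S132 (Suc m). \<sigma> (Suc m) = 1} \<subseteq> S132 m"
  proof clarify
    fix \<sigma> assume s: "\<sigma> \<in> S132 (Suc m)" and f: "\<sigma> (Suc m) = 1"
    have v: "(rot_inv (Suc m) \<circ> \<sigma>) (Suc m) = Suc m"
      using f by (auto simp: rot_inv_def)
    \<comment> \<open>The value \<open>1\<close> is taken at the last position, so earlier values
      are at least 2 and \<open>rot_inv\<close> lowers each by exactly one.\<close>
    have v2: "\<sigma> i = Suc ((rot_inv (Suc m) \<circ> \<sigma>) i)" if "1 \<le> i" "i \<le> m" for i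
      using that S132_le[OF s, of i] injD[OF S132_D(2)[OF s], of i "Suc m"] f
      by (auto simp: rot_inv_def)
    have "rot_inv (Suc m) \<circ> \<sigma> permutes {1..Suc m}"
      by (intro permutes_compose rot_permutes S132_D(1)[OF s]) auto
    then have "rot_inv (Suc m) \<circ> \<sigma> permutes {1..m}"
      by (rule permutes_superset) (use v in \<open>auto simp: atLeastAtMostSuc_conv\<close>)
    moreover have "avoids_132 m (rot_inv (Suc m) \<circ> \<sigma>)"
    proof (rule avoids_132I)
      fix i j k assume *: "1 \<le> i" "i < j" "j < k" "k \<le> m"
        "(rot_inv (Suc m) \<circ> \<sigma>) i < (rot_inv (Suc m) \<circ> \<sigma>) k"
        "(rot_inv (Suc m) \<circ> \<sigma>) k < (rot_inv (Suc m) \<circ> \<sigma>) j"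
      then have w: "\<sigma> i = Suc ((rot_inv (Suc m) \<circ> \<sigma>) i)"
        "\<sigma> j = Suc ((rot_inv (Suc m) \<circ> \<sigma>) j)" "\<sigma> k = Suc ((rot_inv (Suc m) \<circ> \<sigma>) k)"
        by (auto intro!: v2 simp del: comp_apply)
      have "\<sigma> i < \<sigma> k" "\<sigma> k < \<sigma> j"
        using *(5,6) w by linarith+
      then show False using S132_D(3)[OF s, of i j k] * by simp
    qed
    ultimately show "rot_inv (Suc m) \<circ> \<sigma> \<in> S132 m" by (simp add: S132_def)
  qed
qed

section \<open>Coefficients of x^3 as cardinalities\<close>

definition S132_box3 :: "nat \<Rightarrow> (nat \<Rightarrow> nat) set" where
  "S132_box3 n = {\<sigma> \<in> S132 n. box n \<sigma> = 3}"

lemma finite_S132_box3: "finite (S132_box3 n)"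
  by (simp add: S132_box3_def finite_S132)

lemma coeff_sum_monom_box:
  assumes "finite S"
  shows "coeff (\<Sum>\<sigma>\<in>S. monom (1::int) (box n \<sigma>)) 3 = int (card {\<sigma> \<in> S. box n \<sigma> = 3})"
  using assms by (simp add: coeff_sum sum.If_cases Int_def)

lemma coeff_A: "coeff (A n) 3 = int (card (S132_box3 n))"
  unfolding A_def S132_box3_def by (rule coeff_sum_monom_box[OF finite_S132])

lemma coeff_B: "coeff (B n) 3 = int (card {\<sigma> \<in> S132_box3 n. \<sigma> 1 = n})"
proof -
  have "{\<sigma> \<in> {\<sigma> \<in> S132 n. \<sigma> 1 = n}. box n \<sigma> = 3} = {\<sigma> \<in> S132_box3 n. \<sigma> 1 = n}"
    by (auto simp: S132_box3_def)
  then show ?thesis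
    unfolding B_def using coeff_sum_monom_box[of "{\<sigma> \<in> S132 n. \<sigma> 1 = n}"] finite_S132 by simp
qed

lemma coeff_E: "coeff (E n) 3 = int (card {\<sigma> \<in> S132_box3 n. \<sigma> n = n})"
proof -
  have "{\<sigma> \<in> {\<sigma> \<in> S132 n. \<sigma> n = n}. box n \<sigma> = 3} = {\<sigma> \<in> S132_box3 n. \<sigma> n = n}"
    by (auto simp: S132_box3_def)
  then show ?thesis
    unfolding E_def using coeff_sum_monom_box[of "{\<sigma> \<in> S132 n. \<sigma> n = n}"] finite_S132 by simp
qed

section \<open>Box sets after adding an entry at either end\<close>

lemma box_set_Suc_unbonded:
  assumes "\<not> bond \<sigma> m"
  shows "box_set (Suc m) \<sigma> = box_set m \<sigma>"
proof (rule set_eqI)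
  fix i
  show "i \<in> box_set (Suc m) \<sigma> \<longleftrightarrow> i \<in> box_set m \<sigma>"
    using assms by (cases "i = Suc m"; cases "i = m") (auto simp: box_set_def)
qed

lemma box_set_cong:
  assumes "\<And>i. 1 \<le> i \<Longrightarrow> i < m \<Longrightarrow> bond \<sigma> i \<longleftrightarrow> bond \<tau> i"
  shows "box_set m \<sigma> = box_set m \<tau>"
  using assms by (auto simp: box_set_def)

lemma box_set_shift:
  assumes "\<not> bond \<sigma> 1" "\<And>i. 1 \<le> i \<Longrightarrow> i < m \<Longrightarrow> bond \<sigma> (Suc i) \<longleftrightarrow> bond \<tau> i"
  shows "box_set (Suc m) \<sigma> = Suc ` box_set m \<tau>"
proof (rule set_eqI)
  fix i
  show "i \<in> box_set (Suc m) \<sigma> \<longleftrightarrow> i \<in> Suc ` box_set m \<tau>"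
  proof (cases i)
    case (Suc j)
    show ?thesis
    \<comment> \<open>Positions \<open>1\<close> and \<open>2\<close> are special: their only
      difference from the shifted picture is the bond at \<open>1\<close>, which is
      excluded.\<close>
    proof (cases "j \<le> 1")
      case True
      then show ?thesis using Suc assms by (auto simp: box_set_def le_Suc_eq)
    next
      case False
      then have "j \<le> m \<Longrightarrow> bond \<sigma> j \<longleftrightarrow> bond \<tau> (j - 1)"
        using assms(2)[of "j - 1"] by simp
      then show ?thesis using Suc False assms(2)[of j]
        by (auto simp: box_set_def)
    qed
  qed (auto simp: box_set_def)
qed

section \<open>Recurrences for the three counts\<close>

text \<open>Appending a maximum creates a bond exactly when \<open>\<sigma> m = m\<close>, and then
  the box number is at least 4; otherwise it is unchanged. The subtraction is exact because a subset
  is removed.\<close>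

lemma card_S132_box3_max_last:
  assumes "3 \<le> m"
  shows "card {\<sigma> \<in> S132_box3 (Suc m). \<sigma> (Suc m) = Suc m} = card (S132_box3 m) - card {\<sigma> \<in> S132_box3 m. \<sigma> m = m}"
proof -
  have "\<sigma> \<in> S132_box3 (Suc m) \<and> \<sigma> (Suc m) = Suc m \<longleftrightarrow> \<sigma> \<in> S132_box3 m \<and> \<sigma> m \<noteq> m" for \<sigma>
  proof (cases "\<sigma> \<in> S132 m")
    case True
    then have s: "\<sigma> \<in> S132 (Suc m)" "\<sigma> (Suc m) = Suc m" using S132_fix_last[of m] by auto
    have b: "bond \<sigma> m \<longleftrightarrow> \<sigma> m = m"
      using s(2) S132_le[OF True, of m] assms by (auto simp: bond_def)
    show ?thesis
    proof (cases "\<sigma> m = m")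
      case True
      then show ?thesis using box_ge_4_end[OF s(1)] b s assms by (auto simp: S132_box3_def)
    next
      case False
      then show ?thesis using b s \<open>\<sigma> \<in> S132 m\<close> by (simp add: S132_box3_def box_eq_card box_set_Suc_unbonded)
    qed
  next
    case False
    then show ?thesis using S132_fix_last[of m] by (auto simp: S132_box3_def)
  qed
  then have "{\<sigma> \<in> S132_box3 (Suc m). \<sigma> (Suc m) = Suc m} = S132_box3 m - {\<sigma> \<in> S132_box3 m. \<sigma> m = m}" by auto
  then show ?thesis by (simp add: card_Diff_subset finite_S132_box3)
qed

text \<open>The analogue for a prepended maximum, where a new bond arises exactly when
  \<open>\<sigma> 1 = m\<close>.\<close>

lemma card_S132_box3_max_first:
  assumes "3 \<le> m"
  shows "card {\<sigma> \<in> S132_box3 (Suc m). \<sigma> 1 = Suc m} = card (S132_box3 m) - card {\<sigma> \<in> S132_box3 m. \<sigma> 1 = m}"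
proof -
  let ?g = "\<lambda>\<sigma>. \<sigma> \<circ> rot_inv (Suc m)"
  have iff: "box (Suc m) (?g \<sigma>) = 3 \<longleftrightarrow> box m \<sigma> = 3 \<and> \<sigma> 1 \<noteq> m" if s: "\<sigma> \<in> S132 m" for \<sigma>
  proof -
    have g: "?g \<sigma> \<in> S132 (Suc m)" "?g \<sigma> 1 = Suc m"
      using bij_betw_apply[OF S132_max_first s] by auto
    have v: "?g \<sigma> (Suc i) = \<sigma> i" if "1 \<le> i" "i \<le> m" for i using that by (simp add: rot_inv_def)
    \<comment> \<open>The leading \<open>Suc m\<close> is followed by \<open>\<sigma> 1\<close>,
      which is at most \<open>m\<close>, so a bond means equality.\<close>
    have b: "bond (?g \<sigma>) 1 \<longleftrightarrow> \<sigma> 1 = m"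
      unfolding bond_def v[OF order_refl order.trans[OF _ assms], simplified] g(2)
      using v[of 1] S132_le[OF s, of 1] assms by auto
    show ?thesis
    proof (cases "\<sigma> 1 = m")
      case True
      then show ?thesis using box_ge_4_start[OF g(1)] b g assms by auto
    next
      case False
      have "box_set (Suc m) (?g \<sigma>) = Suc ` box_set m \<sigma>"
      proof (rule box_set_shift)
        show "\<not> bond (?g \<sigma>) 1" using b False by simp
      next
        fix i assume "1 \<le> i" "i < m"
        then show "bond (?g \<sigma>) (Suc i) \<longleftrightarrow> bond \<sigma> i"
          unfolding bond_def using v[of i] v[of "Suc i"] by simp
      qed
      then show ?thesis using False by (simp add: box_eq_card card_image)
    qed
  qed
  have "bij_betw ?g {\<sigma> \<in> S132 m. box m \<sigma> = 3 \<and> \<sigma> 1 \<noteq> m}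
      {\<sigma> \<in> {\<sigma> \<in> S132 (Suc m). \<sigma> 1 = Suc m}. box (Suc m) \<sigma> = 3}"
    by (rule bij_betw_Collect[OF S132_max_first]) (rule iff)
  moreover have "{\<sigma> \<in> S132 m. box m \<sigma> = 3 \<and> \<sigma> 1 \<noteq> m} = S132_box3 m - {\<sigma> \<in> S132_box3 m. \<sigma> 1 = m}"
    by (auto simp: S132_box3_def)
  moreover have "{\<sigma> \<in> {\<sigma> \<in> S132 (Suc m). \<sigma> 1 = Suc m}. box (Suc m) \<sigma> = 3}
      = {\<sigma> \<in> S132_box3 (Suc m). \<sigma> 1 = Suc m}"
    by (auto simp: S132_box3_def)
  ultimately have "card {\<sigma> \<in> S132_box3 (Suc m). \<sigma> 1 = Suc m} = card (S132_box3 m - {\<sigma> \<in> S132_box3 m. \<sigma> 1 = m})"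
    using bij_betw_same_card by fastforce
  then show ?thesis by (simp add: card_Diff_subset finite_S132_box3)
qed

text \<open>A maximum in the last position but one forces a trailing \<open>1\<close>. Deleting that
  \<open>1\<close> leaves the maximum last and keeps the box number, since no bond is lost.\<close>

lemma card_S132_box3_max_penultimate:
  assumes "3 \<le> m"
  shows "card {\<sigma> \<in> S132_box3 (Suc m). \<sigma> m = Suc m} = card {\<sigma> \<in> S132_box3 m. \<sigma> m = m}"
proof -
  let ?g = "\<lambda>\<sigma>. rot (Suc m) \<circ> \<sigma>"
  have iff: "box (Suc m) (?g \<sigma>) = 3 \<and> ?g \<sigma> m = Suc m \<longleftrightarrow> box m \<sigma> = 3 \<and> \<sigma> m = m"
    if s: "\<sigma> \<in> S132 m" for \<sigma>
  proof -
    have g: "?g \<sigma> \<in> S132 (Suc m)" "?g \<sigma> (Suc m) = 1"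
      using bij_betw_apply[OF S132_min_last s] by auto
    have v: "?g \<sigma> i = Suc (\<sigma> i)" if "1 \<le> i" "i \<le> m" for i
      using that S132_le[OF s, of i] by (simp add: rot_def)
    have m: "?g \<sigma> m = Suc m \<longleftrightarrow> \<sigma> m = m" using v[of m] assms by simp
    have "box_set (Suc m) (?g \<sigma>) = box_set m \<sigma>" if "\<sigma> m = m"
    proof -
      \<comment> \<open>The last two entries are \<open>Suc m\<close> and \<open>1\<close>, whose
        difference is \<open>m\<close>, at least 3.\<close>
      have "\<not> bond (?g \<sigma>) m" unfolding bond_def g(2) using m that assms by simp
      then have "box_set (Suc m) (?g \<sigma>) = box_set m (?g \<sigma>)" by (rule box_set_Suc_unbonded)
      also have "\<dots> = box_set m \<sigma>"
      proof (rule box_set_cong)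
        fix i assume "1 \<le> i" "i < m"
        then show "bond (?g \<sigma>) i \<longleftrightarrow> bond \<sigma> i"
          unfolding bond_def using v[of i] v[of "Suc i"] by simp
      qed
      finally show ?thesis .
    qed
    then show ?thesis unfolding m by (auto simp: box_eq_card)
  qed
  have "bij_betw ?g {\<sigma> \<in> S132 m. box m \<sigma> = 3 \<and> \<sigma> m = m}
      {\<sigma> \<in> {\<sigma> \<in> S132 (Suc m). \<sigma> (Suc m) = 1}. box (Suc m) \<sigma> = 3 \<and> \<sigma> m = Suc m}"
    by (rule bij_betw_Collect[OF S132_min_last]) (rule iff)
  moreover have "{\<sigma> \<in> S132 m. box m \<sigma> = 3 \<and> \<sigma> m = m} = {\<sigma> \<in> S132_box3 m. \<sigma> m = m}"
    by (auto simp: S132_box3_def)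
  moreover have "\<sigma> (Suc m) = 1" if s: "\<sigma> \<in> S132 (Suc m)" and f: "\<sigma> m = Suc m" for \<sigma>
  proof -
    obtain k where k: "1 \<le> k" "k \<le> Suc m" "\<sigma> k = 1" using S132_preimage[OF s, of 1] by auto
    \<comment> \<open>A \<open>1\<close> before the maximum would form a 132 pattern with the
      maximum and the last entry.\<close>
    have "\<not> k < m"
    proof
      assume "k < m"
      then have "\<sigma> (Suc m) \<noteq> \<sigma> k" "\<sigma> (Suc m) \<noteq> \<sigma> m"
        using inj_eq[OF S132_D(2)[OF s]] by auto
      moreover have "1 \<le> \<sigma> (Suc m)" "\<sigma> (Suc m) \<le> Suc m" using S132_le[OF s, of "Suc m"] by auto
      ultimately show False using S132_D(3)[OF s, of k m "Suc m"] k f \<open>k < m\<close> by simp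
    qed
    moreover have "k \<noteq> m" using k f assms by auto
    ultimately have "k = Suc m" using k by simp
    with k show ?thesis by simp
  qed
  then have "{\<sigma> \<in> {\<sigma> \<in> S132 (Suc m). \<sigma> (Suc m) = 1}. box (Suc m) \<sigma> = 3 \<and> \<sigma> m = Suc m}
      = {\<sigma> \<in> S132_box3 (Suc m). \<sigma> m = Suc m}"
    by (auto simp: S132_box3_def)
  ultimately show ?thesis using bij_betw_same_card by fastforce
qed

text \<open>\<open>position_max_cases\<close> gives the cover; injectivity makes the three cases
  disjoint, as \<open>1\<close>, \<open>m\<close> and \<open>Suc m\<close> differ.\<close>

lemma card_S132_box3_split:
  assumes "3 \<le> m"
  shows "card (S132_box3 (Suc m)) = card {\<sigma> \<in> S132_box3 (Suc m). \<sigma> 1 = Suc m}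
    + card {\<sigma> \<in> S132_box3 (Suc m). \<sigma> m = Suc m} + card {\<sigma> \<in> S132_box3 (Suc m). \<sigma> (Suc m) = Suc m}"
    (is "_ = card ?X + card ?Y + card ?Z")
proof -
  have "S132_box3 (Suc m) = ?X \<union> ?Y \<union> ?Z"
    using position_max_cases[of _ "Suc m"] assms by (auto simp: S132_box3_def)
  moreover have disj: "{\<sigma> \<in> S132_box3 (Suc m). \<sigma> i = k} \<inter> {\<sigma> \<in> S132_box3 (Suc m). \<sigma> j = k} = {}"
    if "i \<noteq> j" for i j k
    using that S132_D(2)[of _ "Suc m"] by (auto simp: S132_box3_def dest: injD)
  have "?X \<inter> ?Y = {}" "(?X \<union> ?Y) \<inter> ?Z = {}"
    using disj[of 1 m "Suc m"] disj[of 1 "Suc m" "Suc m"] disj[of m "Suc m" "Suc m"] assms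
    by auto
  ultimately show ?thesis
    using card_Un_disjoint[of "?X \<union> ?Y" ?Z] card_Un_disjoint[of ?X ?Y] finite_S132_box3 by simp
qed

section \<open>Base case and Fibonacci induction\<close>

text \<open>All three positions must be counted, and each end has only one neighbour, so both
  adjacencies are bonds. This leaves only 123 and 321.\<close>

lemma S132_box3_3: "S132_box3 3 = {id, transpose 1 3}"
proof (intro equalityI subsetI)
  fix \<sigma> assume "\<sigma> \<in> S132_box3 3"
  then have s: "\<sigma> \<in> S132 3" and b: "card (box_set 3 \<sigma>) = 3" by (auto simp: S132_box3_def box_eq_card)
  have "box_set 3 \<sigma> = {1..3}"
    by (rule card_subset_eq) (use b in \<open>auto simp: box_set_def\<close>)
  then have "1 \<in> box_set 3 \<sigma>" "3 \<in> box_set 3 \<sigma>" by auto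
  then have "bond \<sigma> 1" "bond \<sigma> 2" by (auto simp: box_set_def)
  moreover have "\<sigma> 1 \<noteq> \<sigma> 3" using inj_eq[OF S132_D(2)[OF s]] by simp
  moreover have "\<sigma> 1 \<in> {1..3}" "\<sigma> 2 \<in> {1..3}" "\<sigma> 3 \<in> {1..3}"
    using S132_le[OF s] by auto
  ultimately have "\<sigma> 1 = 1 \<and> \<sigma> 2 = 2 \<and> \<sigma> 3 = 3 \<or> \<sigma> 1 = 3 \<and> \<sigma> 2 = 2 \<and> \<sigma> 3 = 1"
    unfolding bond_def by (simp add: numeral_2_eq_2 numeral_3_eq_3) arith
  moreover have "\<sigma> i = i" if "i \<noteq> 1" "i \<noteq> 2" "i \<noteq> 3" for i
    using permutes_not_in[OF S132_D(1)[OF s], of i] that by force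
  ultimately have "(\<forall>i. \<sigma> i = i) \<or> (\<forall>i. \<sigma> i = transpose 1 3 i)"
    by (metis transpose_apply_first transpose_apply_second transpose_apply_other
        numeral_eq_one_iff numeral_eq_iff num.distinct)
  then show "\<sigma> \<in> {id, transpose 1 3}" by (auto simp: fun_eq_iff)
next
  fix \<sigma> :: "nat \<Rightarrow> nat" assume *: "\<sigma> \<in> {id, transpose 1 3}"
  then have "\<sigma> permutes {1..3}" by (auto simp: permutes_id intro: permutes_swap_id)
  moreover have "avoids_132 3 \<sigma>"
  proof (rule avoids_132I)
    fix i j k :: nat assume ijk: "1 \<le> i" "i < j" "j < k" "k \<le> 3" "\<sigma> i < \<sigma> k" "\<sigma> k < \<sigma> j"
    then have "i = 1" "j = 2" "k = 3" by auto
    with ijk * show False by (auto simp: transpose_def)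
  qed
  moreover have "bond \<sigma> 1" "bond \<sigma> 2" using * by (auto simp: bond_def transpose_def)
  then have "box_set 3 \<sigma> = {1..3}"
    by (auto simp: box_set_def atLeastAtMost_def le_Suc_eq numeral_3_eq_3 numeral_2_eq_2)
  ultimately show "\<sigma> \<in> S132_box3 3" by (simp add: S132_box3_def S132_def box_eq_card)
qed

text \<open>The recurrences couple the three counts, hence one joint induction; the offset 3 avoids
  truncated subtraction in the indices.\<close>

lemma card_S132_box3:
  "card (S132_box3 (n + 3)) = F (n + 2) \<and> card {\<sigma> \<in> S132_box3 (n + 3). \<sigma> 1 = n + 3} = F n
    \<and> card {\<sigma> \<in> S132_box3 (n + 3). \<sigma> (n + 3) = n + 3} = F n"
proof (induction n)
  case 0
  have ne: "id \<noteq> transpose (1::nat) 3" by (metis id_apply transpose_apply_first numeral_eq_one_iff num.distinct(3))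
  have "{\<sigma> \<in> S132_box3 3. \<sigma> 1 = 3} = {transpose 1 3}" "{\<sigma> \<in> S132_box3 3. \<sigma> 3 = 3} = {id}"
    unfolding S132_box3_3 by auto
  with ne show ?case by (simp add: S132_box3_3 numeral_2_eq_2)
next
  case (Suc n)
  have m: "3 \<le> n + 3" by simp
  \<comment> \<open>The end counts become \<open>F (n + 2) - F n = F (n + 1)\<close>, and the total
    is \<open>F (n + 1) + F n + F (n + 1) = F (n + 3)\<close>.\<close>
  show ?case
    using card_S132_box3_max_first[OF m] card_S132_box3_max_last[OF m] card_S132_box3_max_penultimate[OF m]
      card_S132_box3_split[OF m] Suc by simp
qed

theorem theorem4:
  fixes n :: nat
  assumes "n \<ge> 3"
  shows "coeff (A n) 3 = int (F (n - 1))
       \<and> coeff (B n) 3 = int (F (n - 3))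
       \<and> coeff (E n) 3 = int (F (n - 3))"
proof -
  obtain m where "n = m + 3" using assms by (metis le_add_diff_inverse2)
  then show ?thesis using card_S132_box3[of m] by (simp add: coeff_A coeff_B coeff_E)
qed

end
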